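(* Let $\mathcal{H}$ be a complex Hilbert space and let $T\in\mathcal{B}(\mathcal{H})$ have closed range. Then the following are equivalent: (1) $T$ is EP. (2) There exists an isomorphism $V\in\mathcal{B}(\mathcal{H})$ such that $T^*=VT$. (3) There exists an injective $N\in\mathcal{B}(\mathcal{H})$ such that $T^*=NT$. (4) There exist $S_1,S_2\in\mathcal{B}(\mathcal{H})$ such that $T^*=S_1T$ and $T=S_2T^*$.
   Context: $\mathcal{B}(\mathcal{H})$ denotes the bounded linear operators on $\mathcal{H}$. $\mathcal{N}(T)$ is the kernel of $T$ and $T^*$ its adjoint. An operator $T\in\mathcal{B}(\mathcal{H})$ with closed range is called EP if $\mathcal{N}(T)=\mathcal{N}(T^* )$. A bounded operator is an isomorphism if it is injective and onto (not necessarily isometric). *)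

theory Defs
  imports "HOL-Analysis.Analysis"
begin

text \<open>
  A complex inner product space is presented as a real inner product space whose scalar
  multiplication extends to the complex numbers and whose real inner product is the real part of
  a sesquilinear form, linear in the first argument. Positive definiteness of \<open>cinner\<close> and
  \<open>norm x = sqrt (Re (cinner x x))\<close> are inherited from \<^class>\<open>real_inner\<close>.
\<close>

class complex_inner = real_inner +
  fixes scaleC :: "complex \<Rightarrow> 'a \<Rightarrow> 'a"  (infixr \<open>*\<^sub>C\<close> 75)
    and cinner :: "'a \<Rightarrow> 'a \<Rightarrow> complex"
  assumes scaleC_add_right: "c *\<^sub>C (x + y) = c *\<^sub>C x + c *\<^sub>C y"
    and scaleC_add_left: "(c + d) *\<^sub>C x = c *\<^sub>C x + d *\<^sub>C x"
    and scaleC_scaleC: "c *\<^sub>C d *\<^sub>C x = (c * d) *\<^sub>C x"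
    and scaleR_scaleC: "r *\<^sub>R x = complex_of_real r *\<^sub>C x"
    and cinner_commute: "cinner x y = cnj (cinner y x)"
    and cinner_add_left: "cinner (x + y) z = cinner x z + cinner y z"
    and cinner_scaleC_left: "cinner (c *\<^sub>C x) y = c * cinner x y"
    and inner_eq_Re_cinner: "x \<bullet> y = Re (cinner x y)"

class complex_hilbert_space = complex_inner + banach

instantiation complex :: complex_hilbert_space
begin

definition scaleC_complex :: "complex \<Rightarrow> complex \<Rightarrow> complex"
  where "scaleC_complex c x = c * x"

definition cinner_complex :: "complex \<Rightarrow> complex \<Rightarrow> complex"
  where "cinner_complex x y = x * cnj y"

instance
  by standard
    (auto simp: scaleC_complex_def cinner_complex_def inner_complex_def scaleR_conv_of_real
      algebra_simps)

end

lemma cinner_self: "cinner x x = complex_of_real ((norm x)\<^sup>2)"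
  for x :: "'a::complex_inner"
proof -
  have "Im (cinner x x) = 0"
    using arg_cong[OF cinner_commute[of x x], of Im] by simp
  moreover have "Re (cinner x x) = (norm x)\<^sup>2"
    by (simp add: power2_norm_eq_inner inner_eq_Re_cinner)
  ultimately show ?thesis
    by (simp add: complex_eq_iff)
qed

definition bounded_clinear :: "('a::complex_inner \<Rightarrow> 'b::complex_inner) \<Rightarrow> bool"
  where "bounded_clinear T \<longleftrightarrow> bounded_linear T \<and> (\<forall>c x. T (c *\<^sub>C x) = c *\<^sub>C T x)"

definition cadjoint ::
    "('a::complex_hilbert_space \<Rightarrow> 'a) \<Rightarrow> 'a \<Rightarrow> 'a"
  where "cadjoint T = (THE S. \<forall>x y. cinner (T x) y = cinner x (S y))"

lemma cadjoint_eqI: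
  fixes T S :: "'a::complex_hilbert_space \<Rightarrow> 'a"
  assumes S: "\<And>x y. cinner (T x) y = cinner x (S y)"
  shows "cadjoint T = S"
  unfolding cadjoint_def
proof (rule the_equality)
  show "\<forall>x y. cinner (T x) y = cinner x (S y)"
    using S by blast
  fix S' assume S': "\<forall>x y. cinner (T x) y = cinner x (S' y)"
  show "S' = S"
  proof
    fix y
    have "\<forall>x. x \<bullet> S' y = x \<bullet> S y"
      using S S' by (metis inner_eq_Re_cinner)
    then show "S' y = S y"
      by (simp add: vector_eq_ldot)
  qed
qed

definition kernel :: "('a::complex_hilbert_space \<Rightarrow> 'a) \<Rightarrow> 'a set"
  where "kernel T = {x. T x = 0}"

definition EP :: "('a::complex_hilbert_space \<Rightarrow> 'a) \<Rightarrow> bool"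
  where "EP T \<longleftrightarrow> bounded_clinear T \<and> closed (range T) \<and> kernel T = kernel (cadjoint T)"

definition isomorphism :: "('a::complex_hilbert_space \<Rightarrow> 'a) \<Rightarrow> bool"
  where "isomorphism V \<longleftrightarrow> bounded_clinear V \<and> inj V \<and> surj V"

end

theory Submission
  imports Defs
begin

text \<open>
  Each factorization in the theorem gives \<open>EP\<close> by comparing kernels: \<open>T\<^sup>* = N T\<close> with \<open>N\<close>
  injective, or \<open>T\<^sup>* = S\<^sub>1 T\<close> together with \<open>T = S\<^sub>2 T\<^sup>*\<close>, makes \<open>T\<close> and \<open>T\<^sup>*\<close> vanish at the
  same points.

  Conversely, let \<open>T\<close> be EP and let \<open>P\<close> be the orthogonal projection onto the closed subspace
  \<open>range T\<close>. The orthogonal complement of \<open>range T\<close> is the kernel of \<open>T\<^sup>*\<close>, hence of \<open>T\<close>, so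
  \<open>T\<close> maps \<open>range T\<close> bijectively onto itself and vanishes on the complement. By the open mapping
  theorem the inverse of this restriction is bounded. Extended by \<open>0\<close> to the complement it is a
  bounded operator \<open>S\<close> with \<open>T S = S T = P\<close> and \<open>P S = S P = S\<close> (\<open>EP_group_inverse\<close>). Taking
  adjoints, \<open>S\<^sup>*\<close> stands in the same relation to \<open>T\<^sup>*\<close>, with the same \<open>P\<close>. Therefore
  \<open>V = T\<^sup>* S + (1 - P)\<close> and \<open>W = T S\<^sup>* + (1 - P)\<close> are inverse to each other and satisfy
  \<open>V T = T\<^sup>*\<close> and \<open>W T\<^sup>* = T\<close> (\<open>EP_cadjoint_factorization\<close>). So \<open>V\<close> is the isomorphism and the
  injective operator sought, and \<open>V, W\<close> are the two factors \<open>S\<^sub>1, S\<^sub>2\<close>.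

  The general facts needed are the projection theorem and the Riesz representation theorem, which
  provide \<open>P\<close> and the existence of adjoints, and the open mapping theorem in the form that an
  operator between Banach spaces with closed range has preimages of proportionally bounded norm
  (\<open>closed_range_bounded_preimage\<close>).
\<close>

section \<open>Orthogonal projection in real Hilbert spaces\<close>

text \<open>The projection theorem: \<open>y\<close> is the point of \<open>M\<close> closest to \<open>x\<close>. It is the limit of a minimizing
  sequence, which is Cauchy by the parallelogram law because \<open>M\<close> contains midpoints.\<close>

lemma closed_subspace_orthogonal_decomposition:
  fixes M :: "'a::{real_inner,banach} set"
  assumes "subspace M" and "closed M"
  obtains y where "y \<in> M" and "\<And>z. z \<in> M \<Longrightarrow> (x - y) \<bullet> z = 0"
proof -
  define D where "D = (\<lambda>y. (norm (x - y))\<^sup>2) ` M"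
  define d where "d = Inf D"
  have "0 \<in> M" using assms(1) by (rule subspace_0)
  then have "D \<noteq> {}" by (auto simp: D_def)
  have "bdd_below D" by (auto simp: D_def intro!: bdd_belowI[of _ 0])
  have d_le: "d \<le> (norm (x - y))\<^sup>2" if "y \<in> M" for y
    unfolding d_def using \<open>bdd_below D\<close> that by (auto simp: D_def intro: cInf_lower)
  have "\<exists>y\<in>M. (norm (x - y))\<^sup>2 < d + inverse (real (Suc n))" for n
  proof -
    have "Inf D < d + inverse (real (Suc n))" by (simp add: d_def)
    from cInf_lessD[OF \<open>D \<noteq> {}\<close> this] show ?thesis by (auto simp: D_def)
  qed
  then obtain s where s: "\<And>n. s n \<in> M"
      and s_less: "\<And>n. (norm (x - s n))\<^sup>2 < d + inverse (real (Suc n))"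
    by metis
  have parallelogram: "(norm (a - b))\<^sup>2
      = 2 * (norm (x - a))\<^sup>2 + 2 * (norm (x - b))\<^sup>2 - 4 * (norm (x - (1/2) *\<^sub>R (a + b)))\<^sup>2" for a b
    unfolding power2_norm_eq_inner
    by (simp add: inner_diff_left inner_diff_right inner_add_left inner_add_right inner_commute
        field_simps)
  have s_dist: "(norm (s m - s n))\<^sup>2 \<le> 2 * inverse (real (Suc m)) + 2 * inverse (real (Suc n))" for m n
  proof -
    have "(1/2) *\<^sub>R (s m + s n) \<in> M"
      using assms(1) s by (simp add: subspace_add subspace_scale)
    then show ?thesis
      using d_le parallelogram[of "s m" "s n"] s_less[of m] s_less[of n] by fastforce
  qed
  have "Cauchy s"
  proof (rule metric_CauchyI)
    fix e :: real assume "e > 0"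
    then obtain N where N: "inverse (real (Suc N)) < e\<^sup>2 / 4"
      using reals_Archimedean[of "e\<^sup>2 / 4"] by auto
    have "dist (s m) (s n) < e" if "m \<ge> N" "n \<ge> N" for m n
    proof -
      have "inverse (real (Suc m)) \<le> inverse (real (Suc N))"
           "inverse (real (Suc n)) \<le> inverse (real (Suc N))"
        using that by (auto intro!: le_imp_inverse_le)
      then have "(norm (s m - s n))\<^sup>2 < e\<^sup>2" using s_dist[of m n] N by linarith
      then show ?thesis using \<open>e > 0\<close> by (simp add: dist_norm power2_less_imp_less)
    qed
    then show "\<exists>N. \<forall>m\<ge>N. \<forall>n\<ge>N. dist (s m) (s n) < e" by blast
  qed
  then obtain y where y: "s \<longlonglongrightarrow> y"
    using Cauchy_convergent convergent_def by blast
  have "y \<in> M"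
    using closed_sequentially[OF assms(2) _ y] s by blast
  have "(norm (x - y))\<^sup>2 \<le> d"
  proof (rule LIMSEQ_le)
    show "(\<lambda>n. (norm (x - s n))\<^sup>2) \<longlonglongrightarrow> (norm (x - y))\<^sup>2" by (intro tendsto_intros y)
    show "(\<lambda>n. d + inverse (real (Suc n))) \<longlonglongrightarrow> d"
      using LIMSEQ_inverse_real_of_nat_add[of d] .
  qed (use s_less in \<open>auto intro: less_imp_le\<close>)
  then have minimal: "(norm (x - y))\<^sup>2 \<le> (norm (x - z))\<^sup>2" if "z \<in> M" for z
    using d_le[OF that] by linarith
  have "(x - y) \<bullet> z = 0" if "z \<in> M" for z
  proof (cases "z = 0")
    case False
    \<comment> \<open>\<open>y + t *\<^sub>R z\<close> is the point closest to \<open>x\<close> on the line through \<open>y\<close> in direction \<open>z\<close>\<close>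
    define t where "t = ((x - y) \<bullet> z) / (z \<bullet> z)"
    have "z \<bullet> z > 0" using False by simp
    have "y + t *\<^sub>R z \<in> M"
      using assms(1) \<open>y \<in> M\<close> that by (simp add: subspace_add subspace_scale)
    then have "(norm (x - y))\<^sup>2 \<le> (norm ((x - y) - t *\<^sub>R z))\<^sup>2"
      using minimal by (simp add: diff_diff_eq)
    also have "\<dots> = (norm (x - y))\<^sup>2 - 2 * t * ((x - y) \<bullet> z) + t\<^sup>2 * (z \<bullet> z)"
      unfolding power2_norm_eq_inner
      by (simp add: inner_diff_left inner_diff_right inner_commute power2_eq_square algebra_simps)
    also have "\<dots> = (norm (x - y))\<^sup>2 - ((x - y) \<bullet> z)\<^sup>2 / (z \<bullet> z)"
      using \<open>z \<bullet> z > 0\<close> unfolding t_def by (simp add: power2_eq_square field_simps)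
    finally have "((x - y) \<bullet> z)\<^sup>2 / (z \<bullet> z) \<le> 0" by simp
    then show ?thesis using \<open>z \<bullet> z > 0\<close> by (simp add: divide_le_0_iff)
  qed simp
  then show thesis using that \<open>y \<in> M\<close> by blast
qed

text \<open>The Riesz representation theorem: the representing vector spans the orthogonal complement
  of the kernel of the functional.\<close>

lemma bounded_functional_inner_representation:
  fixes f :: "'a::{real_inner,banach} \<Rightarrow> real"
  assumes "bounded_linear f"
  obtains z where "\<And>x. f x = x \<bullet> z"
proof (cases "\<forall>x. f x = 0")
  case True
  then show thesis using that[of 0] by simp
next
  case False
  then obtain u where "f u \<noteq> 0" by blast
  interpret f: bounded_linear f by fact
  have "subspace {x. f x = 0}"
    by (auto simp: subspace_def f.add f.scaleR)
  moreover have "closed {x. f x = 0}"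
    by (intro closed_Collect_eq continuous_intros linear_continuous_on assms)
  ultimately obtain y where y: "f y = 0" "\<And>z. f z = 0 \<Longrightarrow> (u - y) \<bullet> z = 0"
    using closed_subspace_orthogonal_decomposition[of "{x. f x = 0}" u] by auto
  define w where "w = u - y"
  have "f w \<noteq> 0" using \<open>f u \<noteq> 0\<close> y by (simp add: w_def f.diff)
  then have "w \<noteq> 0" using f.zero by auto
  have "f x = x \<bullet> ((f w / (w \<bullet> w)) *\<^sub>R w)" for x
  proof -
    have "f (x - (f x / f w) *\<^sub>R w) = 0"
      using \<open>f w \<noteq> 0\<close> by (simp add: f.diff f.scaleR)
    then have "w \<bullet> (x - (f x / f w) *\<^sub>R w) = 0"
      using y(2) by (simp add: w_def)
    then have "x \<bullet> w = (f x / f w) * (w \<bullet> w)"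
      by (simp add: inner_diff_right inner_commute)
    then show ?thesis using \<open>f w \<noteq> 0\<close> \<open>w \<noteq> 0\<close> by simp
  qed
  then show thesis by (rule that)
qed

section \<open>Open mapping theorem for operators with closed range\<close>

text \<open>By Baire's theorem in the range, the closure of the image of some ball contains a nonempty
  relatively open set. By taking differences and scaling, every \<open>y\<close> in the range then has an
  approximate preimage with error at most half the norm of \<open>y\<close>.\<close>

lemma closed_range_approximate_preimage:
  fixes T :: "'a::banach \<Rightarrow> 'b::banach"
  assumes "bounded_linear T" and "closed (range T)"
  obtains M where "\<And>y. y \<in> range T \<Longrightarrow> \<exists>x. norm x \<le> M * norm y \<and> norm (y - T x) \<le> norm y / 2"
proof -
  interpret T: bounded_linear T by fact
  let ?R = "range T"
  let ?X = "top_of_set ?R"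
  define F where "F n = closure (T ` cball 0 (real n))" for n :: nat
  have F_sub: "F n \<subseteq> ?R" for n
    unfolding F_def using assms(2) by (intro closure_minimal) auto
  have F_Un: "\<Union>(range F) = ?R"
  proof
    show "?R \<subseteq> \<Union>(range F)"
    proof clarify
      fix x :: 'a
      obtain n where "norm x \<le> real n" using real_arch_simple by blast
      then have "T x \<in> T ` cball 0 (real n)" by simp
      then show "T x \<in> \<Union>(range F)" unfolding F_def using closure_subset by fast
    qed
  qed (use F_sub in auto)
  have "?X interior_of \<Union>(range F) \<noteq> {}"
    unfolding F_Un using interior_of_topspace[of ?X] by simp
  moreover have "completely_metrizable_space ?X"
    using assms(2) unfolding closed_closedin
    by (rule completely_metrizable_space_closedin[OF completely_metrizable_space_euclidean])
  moreover have "closedin ?X (F n)" for n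
    using F_sub by (simp add: F_def closed_subset)
  moreover have "countable (range F)" by simp
  ultimately have "\<not> (\<forall>n. ?X interior_of F n = {})"
    using Baire_category_alt[of ?X "range F"] by fastforce
  then obtain n where "?X interior_of F n \<noteq> {}" by blast
  then obtain y0 U where "openin ?X U" "y0 \<in> U" "U \<subseteq> F n"
    by (auto simp: interior_of_def)
  then obtain e where "e > 0" "y0 \<in> ?R" and e: "ball y0 e \<inter> ?R \<subseteq> F n"
    unfolding openin_contains_ball by blast
  have near: "\<exists>x. norm x \<le> real n \<and> norm (T x - y) < d" if "y \<in> F n" "d > 0" for y d
    using that unfolding F_def closure_approachable by (force simp: dist_norm)
  have "\<exists>x. norm x \<le> (4 * real n / e) * norm y \<and> norm (y - T x) \<le> norm y / 2" if "y \<in> ?R" for y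
  proof (cases "y = 0")
    case True
    then show ?thesis by (intro exI[of _ 0]) (simp add: T.zero)
  next
    case False
    \<comment> \<open>the scaling brings \<open>y0 + c *\<^sub>R y\<close> within distance \<open>e / 2\<close> of \<open>y0\<close>\<close>
    define c where "c = e / (2 * norm y)"
    have "c > 0" using False \<open>e > 0\<close> by (simp add: c_def)
    have "y0 + c *\<^sub>R y \<in> ?R"
      using \<open>y0 \<in> ?R\<close> that by (metis (no_types, lifting) T.add T.scaleR imageE rangeI)
    moreover have "dist y0 (y0 + c *\<^sub>R y) < e"
      using False \<open>e > 0\<close> by (simp add: dist_norm c_def)
    ultimately have "y0 + c *\<^sub>R y \<in> F n" using e by auto
    then obtain x1 where x1: "norm x1 \<le> real n" "norm (T x1 - (y0 + c *\<^sub>R y)) < e / 8"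
      using near[of _ "e / 8"] \<open>e > 0\<close> by auto
    have "y0 \<in> F n" using e \<open>e > 0\<close> \<open>y0 \<in> ?R\<close> by auto
    then obtain x2 where x2: "norm x2 \<le> real n" "norm (T x2 - y0) < e / 8"
      using near[of _ "e / 8"] \<open>e > 0\<close> by auto
    define x where "x = (1 / c) *\<^sub>R (x1 - x2)"
    have "norm (x1 - x2) \<le> 2 * real n"
      using x1(1) x2(1) norm_triangle_ineq4[of x1 x2] by linarith
    then have "norm x \<le> (1 / c) * (2 * real n)"
      using \<open>c > 0\<close> by (simp add: x_def divide_right_mono)
    also have "\<dots> = (4 * real n / e) * norm y"
      by (simp add: c_def field_simps)
    finally have nx: "norm x \<le> (4 * real n / e) * norm y" .
    have "y - T x = (1 / c) *\<^sub>R ((T x2 - y0) - (T x1 - (y0 + c *\<^sub>R y)))"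
      using \<open>c > 0\<close> by (simp add: x_def T.scaleR T.diff algebra_simps)
    then have "norm (y - T x) = (1 / c) * norm ((T x2 - y0) - (T x1 - (y0 + c *\<^sub>R y)))"
      using \<open>c > 0\<close> by simp
    also have "\<dots> \<le> (1 / c) * (e / 4)"
      using x1(2) x2(2) \<open>c > 0\<close> norm_triangle_ineq4[of "T x2 - y0" "T x1 - (y0 + c *\<^sub>R y)"]
      by (intro mult_left_mono) auto
    also have "\<dots> = norm y / 2"
      using \<open>e > 0\<close> by (simp add: c_def)
    finally show ?thesis using nx by blast
  qed
  then show thesis by (rule that)
qed

text \<open>Approximating the successive residuals gives a geometric series whose sum is an exact
  preimage.\<close>

lemma closed_range_bounded_preimage:
  fixes T :: "'a::banach \<Rightarrow> 'b::banach"
  assumes "bounded_linear T" and "closed (range T)"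
  obtains C where "\<And>y. y \<in> range T \<Longrightarrow> \<exists>x. T x = y \<and> norm x \<le> C * norm y"
proof -
  interpret T: bounded_linear T by fact
  obtain M where "\<And>y. y \<in> range T \<Longrightarrow> \<exists>x. norm x \<le> M * norm y \<and> norm (y - T x) \<le> norm y / 2"
    using closed_range_approximate_preimage[OF assms] by blast
  then obtain g where g: "\<And>y. y \<in> range T \<Longrightarrow> norm (g y) \<le> M * norm y"
      and g_half: "\<And>y. y \<in> range T \<Longrightarrow> norm (y - T (g y)) \<le> norm y / 2"
    by metis
  have "\<exists>x. T x = y \<and> norm x \<le> (2 * \<bar>M\<bar>) * norm y" if "y \<in> range T" for y
  proof -
    \<comment> \<open>the residuals of the successive approximations to \<open>y\<close>\<close>
    define r where "r = rec_nat y (\<lambda>_ z. z - T (g z))"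
    have r0: "r 0 = y" and rS: "r (Suc k) = r k - T (g (r k))" for k
      by (simp_all add: r_def)
    have r_range: "r k \<in> range T" for k
    proof (induction k)
      case 0
      show ?case using that by (simp add: r0)
    next
      case (Suc k)
      then obtain u where "r k = T u" by blast
      then have "r (Suc k) = T (u - g (r k))" by (simp add: rS T.diff)
      then show ?case by simp
    qed
    have r_norm: "norm (r k) \<le> norm y * (1/2) ^ k" for k
    proof (induction k)
      case (Suc k)
      then show ?case using g_half[OF r_range[of k]] by (simp add: rS)
    qed (simp add: r0)
    let ?b = "\<lambda>k. (\<bar>M\<bar> * norm y) * (1/2) ^ k :: real"
    have g_norm: "norm (g (r k)) \<le> ?b k" for k
    proof -
      have "norm (g (r k)) \<le> \<bar>M\<bar> * norm (r k)"
        using g[OF r_range[of k]] by (smt (verit) mult_right_mono norm_ge_zero)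
      also have "\<dots> \<le> \<bar>M\<bar> * (norm y * (1/2) ^ k)"
        using r_norm by (intro mult_left_mono) auto
      finally show ?thesis by simp
    qed
    have b_sums: "?b sums (2 * \<bar>M\<bar> * norm y)"
      using sums_mult[OF geometric_sums[of "1/2::real"], of "\<bar>M\<bar> * norm y"]
      by (simp add: mult_ac)
    have g_summable: "summable (\<lambda>k. norm (g (r k)))"
    proof (rule summable_comparison_test)
      show "\<exists>N. \<forall>k\<ge>N. norm (norm (g (r k))) \<le> ?b k" using g_norm by simp
      show "summable ?b" using b_sums by (rule sums_summable)
    qed
    define x where "x = (\<Sum>k. g (r k))"
    have "norm x \<le> (\<Sum>k. norm (g (r k)))"
      unfolding x_def by (rule summable_norm[OF g_summable])
    also have "\<dots> \<le> (\<Sum>k. ?b k)"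
      using g_norm g_summable sums_summable[OF b_sums] by (rule suminf_le)
    finally have x_norm: "norm x \<le> (2 * \<bar>M\<bar>) * norm y"
      unfolding sums_unique[OF b_sums, symmetric] .
    have "(\<lambda>k. g (r k)) sums x"
      unfolding x_def using summable_norm_cancel[OF g_summable] by (rule summable_sums)
    then have "(\<lambda>k. T (g (r k))) sums T x" by (rule T.sums)
    moreover have "r \<longlonglongrightarrow> 0"
    proof (rule Lim_null_comparison)
      show "\<forall>\<^sub>F k in sequentially. norm (r k) \<le> norm y * (1/2) ^ k" using r_norm by simp
      show "(\<lambda>k. norm y * (1/2) ^ k) \<longlonglongrightarrow> 0"
        by (intro tendsto_mult_right_zero LIMSEQ_power_zero) simp
    qed
    then have "(\<lambda>k. r k - r (Suc k)) sums (r 0 - 0)" by (rule telescope_sums')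
    then have "(\<lambda>k. T (g (r k))) sums y" by (simp add: rS r0)
    ultimately have "T x = y" by (rule sums_unique2)
    with x_norm show ?thesis by blast
  qed
  then show thesis by (rule that)
qed

section \<open>Bounded complex-linear operators, projections and adjoints\<close>

lemma cinner_eqI:
  fixes x y :: "'a::complex_inner"
  assumes "\<And>z. cinner z x = cinner z y"
  shows "x = y"
  using assms by (metis inner_eq_Re_cinner vector_eq_ldot)

lemma cinner_add_right: "cinner x (y + z) = cinner x y + cinner x z"
  by (metis cinner_add_left cinner_commute complex_cnj_add)

lemma cinner_diff_left: "cinner (x - y) z = cinner x z - cinner y z"
  by (metis add_diff_cancel cinner_add_left diff_add_cancel)

lemma cinner_diff_right: "cinner x (y - z) = cinner x y - cinner x z"
  by (metis add_diff_cancel cinner_add_right diff_add_cancel)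

lemma cinner_zero_left [simp]: "cinner 0 x = 0"
  using cinner_diff_left[of 0 0 x] by simp

lemma cinner_zero_right [simp]: "cinner x 0 = 0"
  using cinner_diff_right[of x 0 0] by simp

lemma cinner_scaleC_right: "cinner x (c *\<^sub>C y) = cnj c * cinner x y"
  by (metis cinner_commute cinner_scaleC_left complex_cnj_mult)

lemma cinner_self_eq_0 [simp]: "cinner x x = 0 \<longleftrightarrow> x = 0"
  by (simp add: cinner_self)

lemma scaleC_diff_right: "c *\<^sub>C (x - y) = c *\<^sub>C x - c *\<^sub>C (y::'a::complex_inner)"
  by (metis add_diff_cancel diff_add_cancel scaleC_add_right)

text \<open>Complex-linearity lets complex statements about inner products be read off from real ones.\<close>

lemma cinner_eq_Complex: "cinner x y = Complex (x \<bullet> y) ((- \<i> *\<^sub>C x) \<bullet> y)"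
  by (simp add: complex_eq_iff inner_eq_Re_cinner cinner_scaleC_left)

lemma bounded_clinear_bounded_linear: "bounded_clinear T \<Longrightarrow> bounded_linear T"
  by (simp add: bounded_clinear_def)

lemma bounded_clinear_scaleC: "bounded_clinear T \<Longrightarrow> T (c *\<^sub>C x) = c *\<^sub>C T x"
  by (simp add: bounded_clinear_def)

lemma bounded_clinear_add: "bounded_clinear T \<Longrightarrow> T (x + y) = T x + T y"
  by (simp add: bounded_clinear_def linear_simps)

lemma bounded_clinear_diff: "bounded_clinear T \<Longrightarrow> T (x - y) = T x - T y"
  by (simp add: bounded_clinear_def linear_simps)

lemma bounded_clinear_zero: "bounded_clinear T \<Longrightarrow> T 0 = 0"
  by (simp add: bounded_clinear_def linear_simps)

lemma bounded_clinearI: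
  assumes "\<And>x y. T (x + y) = T x + T y" and "\<And>c x. T (c *\<^sub>C x) = c *\<^sub>C T x"
    and "\<And>x. norm (T x) \<le> K * norm x"
  shows "bounded_clinear T"
  unfolding bounded_clinear_def
proof
  show "bounded_linear T"
    by (rule bounded_linear_intro[of T K])
       (use assms in \<open>simp_all add: scaleR_scaleC mult.commute\<close>)
qed (use assms in blast)

lemma bounded_clinear_ident: "bounded_clinear (\<lambda>x. x)"
  by (simp add: bounded_clinear_def bounded_linear_ident)

lemma bounded_clinear_compose:
  "bounded_clinear f \<Longrightarrow> bounded_clinear g \<Longrightarrow> bounded_clinear (\<lambda>x. f (g x))"
  by (simp add: bounded_clinear_def bounded_linear_compose)

lemma bounded_clinear_plus:
  "bounded_clinear f \<Longrightarrow> bounded_clinear g \<Longrightarrow> bounded_clinear (\<lambda>x. f x + g x)"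
  by (simp add: bounded_clinear_def bounded_linear_add scaleC_add_right)

lemma bounded_clinear_minus:
  "bounded_clinear f \<Longrightarrow> bounded_clinear g \<Longrightarrow> bounded_clinear (\<lambda>x. f x - g x)"
  by (simp add: bounded_clinear_def bounded_linear_sub scaleC_diff_right)

text \<open>On a subspace closed under complex scalars, orthogonality for the real inner product is
  orthogonality for \<^const>\<open>cinner\<close>, so the real projection is complex-linear.\<close>

lemma orthogonal_projection:
  fixes M :: "'a::complex_hilbert_space set"
  assumes "subspace M" and "\<And>c x. x \<in> M \<Longrightarrow> c *\<^sub>C x \<in> M" and "closed M"
  obtains P where "bounded_clinear P" and "range P \<subseteq> M" and "\<And>x. x \<in> M \<Longrightarrow> P x = x"
    and "\<And>x z. z \<in> M \<Longrightarrow> cinner (x - P x) z = 0" and "\<And>x y. cinner (P x) y = cinner x (P y)"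
proof -
  have "\<exists>y\<in>M. \<forall>z\<in>M. (x - y) \<bullet> z = 0" for x
    using closed_subspace_orthogonal_decomposition[OF assms(1,3)] by metis
  then obtain P where P_in: "\<And>x. P x \<in> M" and P_inner: "\<And>x z. z \<in> M \<Longrightarrow> (x - P x) \<bullet> z = 0"
    by metis
  have orth: "cinner (x - P x) z = 0" if "z \<in> M" for x z
  proof -
    have "Im (cinner (x - P x) z) = (x - P x) \<bullet> (\<i> *\<^sub>C z)"
      by (simp add: inner_eq_Re_cinner cinner_scaleC_right)
    then show ?thesis
      using P_inner that assms(2) by (simp add: complex_eq_iff inner_eq_Re_cinner)
  qed
  have orth': "cinner z (x - P x) = 0" if "z \<in> M" for x z
    using orth[OF that] by (metis cinner_commute complex_cnj_zero)
  have unique: "P x = y" if "y \<in> M" and y: "\<And>z. z \<in> M \<Longrightarrow> cinner (x - y) z = 0" for x y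
  proof -
    have "P x - y \<in> M" using assms(1) P_in that(1) by (simp add: subspace_diff)
    then have "cinner (x - y) (P x - y) - cinner (x - P x) (P x - y) = 0"
      using orth y by simp
    then have "cinner (P x - y) (P x - y) = 0"
      by (simp add: cinner_diff_left[symmetric])
    then show ?thesis by simp
  qed
  have "bounded_clinear P"
  proof (rule bounded_clinearI[where K = 1])
    show "P (x + y) = P x + P y" for x y
    proof (rule unique)
      show "P x + P y \<in> M" using assms(1) P_in by (simp add: subspace_add)
      show "cinner (x + y - (P x + P y)) z = 0" if "z \<in> M" for z
        using orth[OF that, of x] orth[OF that, of y]
        by (simp add: cinner_diff_left cinner_add_left)
    qed
    show "P (c *\<^sub>C x) = c *\<^sub>C P x" for c x
    proof (rule unique)
      show "c *\<^sub>C P x \<in> M" using assms(2) P_in by simp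
      show "cinner (c *\<^sub>C x - c *\<^sub>C P x) z = 0" if "z \<in> M" for z
        using orth[OF that, of x] by (simp add: scaleC_diff_right[symmetric] cinner_scaleC_left)
    qed
    show "norm (P x) \<le> 1 * norm x" for x
    proof -
      have "(norm (P x))\<^sup>2 = x \<bullet> P x"
        using P_inner[OF P_in[of x], of x] by (simp add: power2_norm_eq_inner inner_diff_left)
      also have "\<dots> \<le> norm x * norm (P x)" by (rule norm_cauchy_schwarz)
      finally have "norm (P x) * norm (P x) \<le> norm x * norm (P x)"
        by (simp add: power2_eq_square)
      then show ?thesis
        by (cases "norm (P x) = 0") auto
    qed
  qed
  moreover have "P x = x" if "x \<in> M" for x by (rule unique) (use that in auto)
  moreover have "cinner (P x) y = cinner x (P y)" for x y
    using orth[OF P_in[of y], of x] orth'[OF P_in[of x], of y]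
    by (simp add: cinner_diff_left cinner_diff_right)
  ultimately show thesis using that P_in orth by blast
qed

text \<open>The Riesz representation of \<open>x \<mapsto> T x \<bullet> y\<close> yields the adjoint for the real inner product, which
  is then the adjoint for \<^const>\<open>cinner\<close> because \<open>T\<close> commutes with multiplication by \<open>\<i>\<close>.\<close>

lemma cadjoint_exists:
  fixes T :: "'a::complex_hilbert_space \<Rightarrow> 'a"
  assumes "bounded_clinear T"
  shows "\<exists>S. bounded_clinear S \<and> (\<forall>x y. cinner (T x) y = cinner x (S y))"
proof -
  interpret T: bounded_linear T by (rule bounded_clinear_bounded_linear[OF assms])
  have "\<exists>z. \<forall>x. T x \<bullet> y = x \<bullet> z" for y
    using bounded_functional_inner_representation[of "\<lambda>x. T x \<bullet> y"]
      bounded_linear_inner_left_comp[OF T.bounded_linear_axioms] by metis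
  then obtain S where S: "\<And>x y. T x \<bullet> y = x \<bullet> S y" by metis
  have adj: "cinner (T x) y = cinner x (S y)" for x y
    unfolding cinner_eq_Complex
    by (simp add: S bounded_clinear_scaleC[OF assms, symmetric])
  obtain K where K: "\<And>x. norm (T x) \<le> norm x * K" and "K \<ge> 0"
    using T.nonneg_bounded by blast
  have "bounded_clinear S"
  proof (rule bounded_clinearI)
    show "S (x + y) = S x + S y" for x y
      by (rule cinner_eqI) (simp add: cinner_add_right adj[symmetric])
    show "S (c *\<^sub>C x) = c *\<^sub>C S x" for c x
      by (rule cinner_eqI) (simp add: cinner_scaleC_right adj[symmetric])
    show "norm (S y) \<le> K * norm y" for y
    proof -
      have "(norm (S y))\<^sup>2 = T (S y) \<bullet> y" by (simp add: S power2_norm_eq_inner)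
      also have "\<dots> \<le> norm (T (S y)) * norm y" by (rule norm_cauchy_schwarz)
      also have "\<dots> \<le> (norm (S y) * K) * norm y" by (intro mult_right_mono K) simp
      finally have "norm (S y) * norm (S y) \<le> norm (S y) * (K * norm y)"
        by (simp add: power2_eq_square mult.assoc)
      then show ?thesis using \<open>K \<ge> 0\<close>
        by (cases "norm (S y) = 0") auto
    qed
  qed
  with adj show ?thesis by blast
qed

lemma
  assumes "bounded_clinear T"
  shows bounded_clinear_cadjoint: "bounded_clinear (cadjoint T)"
    and cinner_cadjoint: "cinner (T x) y = cinner x (cadjoint T y)"
proof -
  obtain S where "bounded_clinear S" and S: "\<And>x y. cinner (T x) y = cinner x (S y)"
    using cadjoint_exists[OF assms] by blast
  moreover have "cadjoint T = S" by (rule cadjoint_eqI) (rule S)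
  ultimately show "bounded_clinear (cadjoint T)" "cinner (T x) y = cinner x (cadjoint T y)"
    by simp_all
qed

section \<open>The group inverse of an EP operator\<close>

text \<open>Here \<open>P\<close> is the orthogonal projection onto \<open>range T\<close>, and \<open>S\<close> is the inverse of \<open>T\<close> restricted
  to its range, extended by \<open>0\<close> to the kernel of \<open>T\<close>.\<close>

lemma EP_group_inverse:
  fixes T :: "'a::complex_hilbert_space \<Rightarrow> 'a"
  assumes "EP T"
  obtains P S where "bounded_clinear P" and "bounded_clinear S"
    and "\<And>x. P (P x) = P x" and "\<And>x y. cinner (P x) y = cinner x (P y)"
    and "\<And>x. P (T x) = T x" and "\<And>x. T (P x) = T x"
    and "\<And>x. T (S x) = P x" and "\<And>x. S (T x) = P x"
    and "\<And>x. P (S x) = S x" and "\<And>x. S (P x) = S x"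
proof -
  have T: "bounded_clinear T" and "closed (range T)" and ker: "cadjoint T x = 0 \<longleftrightarrow> T x = 0" for x
    using assms by (auto simp: EP_def kernel_def)
  interpret T: bounded_linear T by (rule bounded_clinear_bounded_linear[OF T])
  have "subspace (range T)"
    using linear_subspace_image[OF T.linear_axioms subspace_UNIV] .
  moreover have "c *\<^sub>C x \<in> range T" if "x \<in> range T" for c x
    using that by (metis bounded_clinear_scaleC[OF T] imageE rangeI)
  ultimately obtain P where P: "bounded_clinear P" and P_range: "range P \<subseteq> range T"
    and P_id: "\<And>x. x \<in> range T \<Longrightarrow> P x = x"
    and P_orth: "\<And>x z. z \<in> range T \<Longrightarrow> cinner (x - P x) z = 0"
    and P_self: "\<And>x y. cinner (P x) y = cinner x (P y)"
    using orthogonal_projection[of "range T"] \<open>closed (range T)\<close> by blast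
  have PP: "P (P x) = P x" for x using P_range P_id by blast
  have PT: "P (T x) = T x" for x using P_id by blast
  \<comment> \<open>\<open>x - P x\<close> is orthogonal to the range, hence in the kernel of \<open>T\<^sup>*\<close>, which is that of \<open>T\<close>\<close>
  have TP: "T (P x) = T x" for x
  proof -
    have "cadjoint T (x - P x) = 0"
    proof (rule cinner_eqI)
      fix z
      have "cinner z (cadjoint T (x - P x)) = cinner (T z) (x - P x)"
        by (simp add: cinner_cadjoint[OF T])
      also have "\<dots> = cnj (cinner (x - P x) (T z))" by (rule cinner_commute)
      also have "\<dots> = 0" using P_orth by simp
      finally show "cinner z (cadjoint T (x - P x)) = cinner z 0" by simp
    qed
    then have "T (x - P x) = 0" using ker by simp
    then show ?thesis by (simp add: T.diff)
  qed
  \<comment> \<open>\<open>range T\<close> is orthogonal to the kernel of \<open>T\<^sup>*\<close>, so it meets the kernel of \<open>T\<close> only in \<open>0\<close>\<close>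
  have inj: "x = y" if xy: "x \<in> range T" "y \<in> range T" "T x = T y" for x y
  proof -
    have "cadjoint T (x - y) = 0" using xy(3) ker by (simp add: T.diff)
    moreover obtain v where "x - y = T v" using xy(1,2) by (metis T.diff imageE)
    ultimately have "cinner (x - y) (x - y) = 0"
      by (metis cinner_cadjoint[OF T] cinner_zero_right)
    then show ?thesis by simp
  qed
  obtain C where C: "\<And>y. y \<in> range T \<Longrightarrow> \<exists>x. T x = y \<and> norm x \<le> C * norm y"
    using closed_range_bounded_preimage[OF T.bounded_linear_axioms \<open>closed (range T)\<close>] by blast
  have "\<exists>x. T x = P y \<and> norm x \<le> C * norm (P y)" for y
    using C P_range by blast
  then obtain g where Tg: "\<And>y. T (g y) = P y" and g_norm: "\<And>y. norm (g y) \<le> C * norm (P y)"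
    by metis
  obtain K where K: "\<And>x. norm (P x) \<le> norm x * K" and "K \<ge> 0"
    using bounded_linear.nonneg_bounded[OF bounded_clinear_bounded_linear[OF P]] by blast
  \<comment> \<open>applying \<open>P\<close> selects the preimage of \<open>P y\<close> that lies in the range\<close>
  define S where "S y = P (g y)" for y
  have TS: "T (S y) = P y" for y by (simp add: S_def TP Tg)
  have S_eqI: "S y = x" if "P x = x" "T x = P y" for x y
  proof (rule inj)
    show "S y \<in> range T" using P_range by (auto simp: S_def)
    show "x \<in> range T" using P_range that(1) by (metis rangeI subsetD)
    show "T (S y) = T x" by (simp add: TS that(2))
  qed
  have PS: "P (S y) = S y" for y by (simp add: S_def PP)
  have "bounded_clinear S"
  proof (rule bounded_clinearI)
    show "S (x + y) = S x + S y" for x y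
      by (rule S_eqI) (simp_all add: bounded_clinear_add[OF P] PS T.add TS)
    show "S (c *\<^sub>C x) = c *\<^sub>C S x" for c x
      by (rule S_eqI)
         (simp_all add: bounded_clinear_scaleC[OF P] PS bounded_clinear_scaleC[OF T] TS)
    show "norm (S y) \<le> (\<bar>C\<bar> * K * K) * norm y" for y
    proof -
      have "norm (S y) \<le> norm (g y) * K" unfolding S_def by (rule K)
      also have "\<dots> \<le> (\<bar>C\<bar> * norm (P y)) * K"
        using g_norm[of y] \<open>K \<ge> 0\<close> by (intro mult_right_mono order_trans[OF g_norm]) auto
      also have "\<dots> \<le> (\<bar>C\<bar> * (norm y * K)) * K"
        using \<open>K \<ge> 0\<close> by (intro mult_right_mono mult_left_mono K) auto
      finally show ?thesis by (simp add: mult_ac)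
    qed
  qed
  moreover have "S (T x) = P x" for x by (rule S_eqI) (simp_all add: PP TP PT)
  moreover have "S (P x) = S x" for x by (rule S_eqI) (simp_all add: PP PS TS)
  ultimately show thesis
    by (intro that[of P S] P PP P_self PT TP TS PS)
qed

text \<open>With \<open>P\<close> and \<open>S\<close> as in the group inverse, the two mutually inverse operators are
  \<open>V = T\<^sup>* S + (1 - P)\<close> and \<open>W = T S\<^sup>* + (1 - P)\<close>.\<close>

lemma EP_cadjoint_factorization:
  fixes T :: "'a::complex_hilbert_space \<Rightarrow> 'a"
  assumes "EP T"
  obtains V W where "bounded_clinear V" and "bounded_clinear W"
    and "\<And>x. V (W x) = x" and "\<And>x. W (V x) = x"
    and "cadjoint T = V \<circ> T" and "T = W \<circ> cadjoint T"
proof -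
  have T: "bounded_clinear T" using assms by (simp add: EP_def)
  obtain P S where P: "bounded_clinear P" and S: "bounded_clinear S"
    and PP: "\<And>x. P (P x) = P x" and P_self: "\<And>x y. cinner (P x) y = cinner x (P y)"
    and PT: "\<And>x. P (T x) = T x" and TP: "\<And>x. T (P x) = T x"
    and TS: "\<And>x. T (S x) = P x" and ST: "\<And>x. S (T x) = P x"
    and PS: "\<And>x. P (S x) = S x" and SP: "\<And>x. S (P x) = S x"
    using EP_group_inverse[OF assms] by blast
  define A where "A = cadjoint T"
  define B where "B = cadjoint S"
  have A: "bounded_clinear A" and B: "bounded_clinear B"
    unfolding A_def B_def by (intro bounded_clinear_cadjoint T S)+
  note adj = cinner_cadjoint[OF T, folded A_def, symmetric]
    cinner_cadjoint[OF S, folded B_def, symmetric] P_self[symmetric]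
  \<comment> \<open>the adjoints of the identities between \<open>T\<close>, \<open>S\<close> and \<open>P\<close>\<close>
  have AP: "A (P x) = A x" and PA: "P (A x) = A x" and AB: "A (B x) = P x" and BA: "B (A x) = P x"
    and BP: "B (P x) = B x" and PB: "P (B x) = B x" for x
    by (rule cinner_eqI, simp add: adj PT TP TS ST PS SP)+
  define V where "V x = A (S x) + (x - P x)" for x
  define W where "W x = T (B x) + (x - P x)" for x
  note linear = bounded_clinear_add[OF P] bounded_clinear_diff[OF P]
    bounded_clinear_add[OF S] bounded_clinear_diff[OF S]
    bounded_clinear_add[OF B] bounded_clinear_diff[OF B]
  show thesis
  proof (rule that)
    show "bounded_clinear V" "bounded_clinear W"
      unfolding V_def W_def
      by (intro bounded_clinear_plus bounded_clinear_minus bounded_clinear_ident P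
          bounded_clinear_compose[OF A S] bounded_clinear_compose[OF T B])+
    show "V (W x) = x" "W (V x) = x" for x
      unfolding V_def W_def
      by (simp_all add: linear PP PT TS ST PS SP PA AB BA BP PB)
    show "cadjoint T = V \<circ> T" "T = W \<circ> cadjoint T"
      unfolding A_def[symmetric] by (simp_all add: fun_eq_iff V_def W_def ST PT AP BA PA TP)
  qed
qed

section \<open>Characterizations of EP operators\<close>

lemma EP_if_cadjoint_eq_injective_comp:
  assumes "bounded_clinear T" and "closed (range T)"
    and "bounded_clinear N" and "inj N" and "cadjoint T = N \<circ> T"
  shows "EP T"
proof -
  have "cadjoint T x = 0 \<longleftrightarrow> T x = 0" for x
    using assms(4,5) bounded_clinear_zero[OF assms(3)] by (metis comp_apply injD)
  then show ?thesis using assms(1,2) by (simp add: EP_def kernel_def)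
qed

theorem proposition4p1:
  fixes T :: "'a::complex_hilbert_space \<Rightarrow> 'a"
  assumes "bounded_clinear T" and "closed (range T)"
  shows "(EP T \<longleftrightarrow> (\<exists>V. isomorphism V \<and> cadjoint T = V \<circ> T)) \<and>
         (EP T \<longleftrightarrow> (\<exists>N. bounded_clinear N \<and> inj N \<and> cadjoint T = N \<circ> T)) \<and>
         (EP T \<longleftrightarrow> (\<exists>S1 S2. bounded_clinear S1 \<and> bounded_clinear S2 \<and>
                           cadjoint T = S1 \<circ> T \<and> T = S2 \<circ> cadjoint T))"
proof -
  have iso: "\<exists>V. isomorphism V \<and> cadjoint T = V \<circ> T"
    and two: "\<exists>S1 S2. bounded_clinear S1 \<and> bounded_clinear S2 \<and>
                cadjoint T = S1 \<circ> T \<and> T = S2 \<circ> cadjoint T" if EP: "EP T"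
  proof -
    obtain V W where V: "bounded_clinear V" and W: "bounded_clinear W"
      and VW: "\<And>x. V (W x) = x" and WV: "\<And>x. W (V x) = x"
      and fact: "cadjoint T = V \<circ> T" "T = W \<circ> cadjoint T"
      using EP_cadjoint_factorization[OF EP] by blast
    have "isomorphism V"
      unfolding isomorphism_def using V VW WV by (metis injI surjI)
    with fact(1) show "\<exists>V. isomorphism V \<and> cadjoint T = V \<circ> T" by blast
    show "\<exists>S1 S2. bounded_clinear S1 \<and> bounded_clinear S2 \<and>
                cadjoint T = S1 \<circ> T \<and> T = S2 \<circ> cadjoint T"
      using V W fact by blast
  qed
  have inj: "EP T" if "bounded_clinear N \<and> inj N \<and> cadjoint T = N \<circ> T" for N
    using EP_if_cadjoint_eq_injective_comp[OF assms] that by blast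
  have "EP T" if S1: "bounded_clinear S1" and S2: "bounded_clinear S2"
    and fact: "cadjoint T = S1 \<circ> T" "T = S2 \<circ> cadjoint T" for S1 S2
  proof -
    have "cadjoint T x = 0 \<longleftrightarrow> T x = 0" for x
      using bounded_clinear_zero[OF S1] bounded_clinear_zero[OF S2] fact by (metis comp_apply)
    then show ?thesis using assms by (simp add: EP_def kernel_def)
  qed
  then show ?thesis
    using iso two inj unfolding isomorphism_def by blast
qed

end
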